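(* Let $\mathbf{k}$ be a unitary commutative ring, let $m\ge2$ be an integer and let $(R,P)$ be a Reynolds algebra of weight $-1$ over $\mathbf{k}$. Then for all $u_1,\dots,u_m\in R$, $$(m-1)P\Big(\prod_{i=1}^{m}P(u_i)\Big)=\sum_{i=1}^{m}P\big(P(u_1)\cdots P(u_{i-1})\,u_i\,P(u_{i+1})\cdots P(u_m)\big)-\prod_{i=1}^{m}P(u_i).$$
   Context: Algebras are unitary associative (not necessarily commutative) $\mathbf{k}$-algebras; products $\prod_{i=1}^m$ are taken in the order $1,2,\dots,m$. A Reynolds algebra of weight $-1$ is a pair $(R,P)$ with $R$ a $\mathbf{k}$-algebra and $P:R\to R$ a $\mathbf{k}$-linear map satisfying $P(u)P(v)=P(uP(v))+P(P(u)v)-P(P(u)P(v))$ for all $u,v\in R$. *)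

theory Defs
  imports "HOL-Algebra.Algebra"
begin

text \<open>
  The locale \<open>algebra\<close> of HOL-Algebra requires the multiplication of the algebra to be
  commutative; here only the base ring is commutative, so left and right compatibility of the
  scalar action with multiplication are separate axioms. The zero ring is allowed on both sides.
\<close>

locale assoc_unital_algebra = module K R + ring R
  for K (structure) and R (structure) +
  assumes smult_mult_left:
      "\<lbrakk>a \<in> carrier K; x \<in> carrier R; y \<in> carrier R\<rbrakk> \<Longrightarrow>
        (a \<odot>\<^bsub>R\<^esub> x) \<otimes>\<^bsub>R\<^esub> y = a \<odot>\<^bsub>R\<^esub> (x \<otimes>\<^bsub>R\<^esub> y)"
    and smult_mult_right:
      "\<lbrakk>a \<in> carrier K; x \<in> carrier R; y \<in> carrier R\<rbrakk> \<Longrightarrow>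
        x \<otimes>\<^bsub>R\<^esub> (a \<odot>\<^bsub>R\<^esub> y) = a \<odot>\<^bsub>R\<^esub> (x \<otimes>\<^bsub>R\<^esub> y)"

text \<open>Reynolds algebras of weight \<open>-1\<close>.\<close>

locale reynolds_algebra_weight_m1 = assoc_unital_algebra K R
  for K (structure) and R (structure) +
  fixes P :: "'c \<Rightarrow> 'c"
  assumes P_closed: "P \<in> carrier R \<rightarrow> carrier R"
    and P_add: "\<lbrakk>x \<in> carrier R; y \<in> carrier R\<rbrakk> \<Longrightarrow> P (x \<oplus>\<^bsub>R\<^esub> y) = P x \<oplus>\<^bsub>R\<^esub> P y"
    and P_smult: "\<lbrakk>a \<in> carrier K; x \<in> carrier R\<rbrakk> \<Longrightarrow> P (a \<odot>\<^bsub>R\<^esub> x) = a \<odot>\<^bsub>R\<^esub> P x"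
    and reynolds: "\<lbrakk>u \<in> carrier R; v \<in> carrier R\<rbrakk> \<Longrightarrow>
        P u \<otimes>\<^bsub>R\<^esub> P v =
          (P (u \<otimes>\<^bsub>R\<^esub> P v) \<oplus>\<^bsub>R\<^esub> P (P u \<otimes>\<^bsub>R\<^esub> v)) \<ominus>\<^bsub>R\<^esub> P (P u \<otimes>\<^bsub>R\<^esub> P v)"

text \<open>
  The ordered product \<open>f i \<otimes> f (i+1) \<otimes> \<dots> \<otimes> f j\<close>, equal to \<open>\<one>\<close> when \<open>j < i\<close>.
  (\<open>finprod\<close> is only meaningful for commutative multiplication.)
\<close>

definition ordprod :: "('a, 'b) monoid_scheme \<Rightarrow> (nat \<Rightarrow> 'a) \<Rightarrow> nat \<Rightarrow> nat \<Rightarrow> 'a"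
  where "ordprod G f i j = foldr (\<otimes>\<^bsub>G\<^esub>) (map f [i..<Suc j]) \<one>\<^bsub>G\<^esub>"

end

theory Submission
  imports Defs
begin

text \<open>
  Write \<open>X\<^sub>m\<close> for the product of the \<open>P (u i)\<close> and \<open>S\<^sub>m\<close> for the sum of the products in which
  one factor \<open>P (u i)\<close> is replaced by \<open>u i\<close>. The identity says that \<open>X\<^sub>m\<close> is the image under \<open>P\<close>
  of \<open>S\<^sub>m - (m - 1) X\<^sub>m\<close>. Hence the Reynolds identity applies to
  \<open>X\<^sub>m P(u\<^sub>m\<^sub>+\<^sub>1)\<close>, and induction on \<open>m\<close> works over any base ring.
\<close>

lemma (in monoid) foldr_mult_closed:
  "set xs \<subseteq> carrier G \<Longrightarrow> y \<in> carrier G \<Longrightarrow> foldr (\<otimes>) xs y \<in> carrier G"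
  by (induction xs) auto

lemma (in monoid) foldr_mult_right:
  "set xs \<subseteq> carrier G \<Longrightarrow> y \<in> carrier G \<Longrightarrow> foldr (\<otimes>) xs y = foldr (\<otimes>) xs \<one> \<otimes> y"
  by (induction xs) (auto simp: m_assoc foldr_mult_closed)

lemma (in monoid) ordprod_closed:
  "(\<And>k. k \<in> {i..j} \<Longrightarrow> f k \<in> carrier G) \<Longrightarrow> ordprod G f i j \<in> carrier G"
  unfolding ordprod_def by (rule foldr_mult_closed) auto

lemma ordprod_empty: "j < i \<Longrightarrow> ordprod G f i j = \<one>\<^bsub>G\<^esub>"
  by (simp add: ordprod_def)

text \<open>\<open>foldr\<close> unfolds from the left, while the induction on the length needs the
  last factor split off on the right. The case \<open>i = Suc j\<close>, where the remaining product
  is empty, is included because a replaced factor may be the last one before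
  \<open>Suc j\<close>.\<close>

lemma (in monoid) ordprod_Suc:
  assumes "i \<le> Suc j" and f: "\<And>k. k \<in> {i..Suc j} \<Longrightarrow> f k \<in> carrier G"
  shows "ordprod G f i (Suc j) = ordprod G f i j \<otimes> f (Suc j)"
proof -
  have "[i..<Suc (Suc j)] = [i..<Suc j] @ [Suc j]" "f (Suc j) \<in> carrier G"
    using assms by auto
  then have "ordprod G f i (Suc j) = foldr (\<otimes>) (map f [i..<Suc j]) (f (Suc j))"
    by (simp add: ordprod_def del: upt_Suc)
  also have "\<dots> = ordprod G f i j \<otimes> f (Suc j)"
    unfolding ordprod_def by (rule foldr_mult_right) (use assms in auto)
  finally show ?thesis .
qed

text \<open>This is the Leibniz expansion of the product of the \<open>f k\<close>, with
  \<open>u k\<close> standing for the derivative of \<open>f k\<close>. Leaving \<open>f\<close>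
  arbitrary keeps the recursion below a matter of pure ring algebra.\<close>

definition replaced_sum :: "('a, 'b) ring_scheme \<Rightarrow> (nat \<Rightarrow> 'a) \<Rightarrow> (nat \<Rightarrow> 'a) \<Rightarrow> nat \<Rightarrow> 'a"
  where "replaced_sum R f u m =
    (\<Oplus>\<^bsub>R\<^esub>i\<in>{1..m}. ordprod R f 1 (i - 1) \<otimes>\<^bsub>R\<^esub> u i \<otimes>\<^bsub>R\<^esub> ordprod R f (i + 1) m)"

context ring
begin

lemma replaced_term_closed:
  assumes "\<And>k. k \<in> {1..m} \<Longrightarrow> f k \<in> carrier R" "\<And>k. k \<in> {1..m} \<Longrightarrow> u k \<in> carrier R"
    and "i \<in> {1..m}"
  shows "ordprod R f 1 (i - 1) \<otimes> u i \<otimes> ordprod R f (i + 1) m \<in> carrier R"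
  using assms by (intro m_closed ordprod_closed) auto

lemma replaced_sum_closed:
  assumes "\<And>k. k \<in> {1..m} \<Longrightarrow> f k \<in> carrier R" "\<And>k. k \<in> {1..m} \<Longrightarrow> u k \<in> carrier R"
  shows "replaced_sum R f u m \<in> carrier R"
  unfolding replaced_sum_def
  by (intro finsum_closed Pi_I replaced_term_closed assms)

text \<open>The Leibniz rule for the product of the first \<open>m\<close> factors with
  \<open>f (Suc m)\<close>: either the replaced factor is among the first \<open>m\<close>, and
  \<open>f (Suc m)\<close> stays on the right, or it is the last one.\<close>

lemma replaced_sum_Suc:
  assumes f: "\<And>k. k \<in> {1..Suc m} \<Longrightarrow> f k \<in> carrier R"
    and u: "\<And>k. k \<in> {1..Suc m} \<Longrightarrow> u k \<in> carrier R"
  shows "replaced_sum R f u (Suc m) =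
    replaced_sum R f u m \<otimes> f (Suc m) \<oplus> ordprod R f 1 m \<otimes> u (Suc m)"
proof -
  let ?t = "\<lambda>n i. ordprod R f 1 (i - 1) \<otimes> u i \<otimes> ordprod R f (i + 1) n"
  have t: "?t m i \<in> carrier R" if "i \<in> {1..m}" for i
    by (rule replaced_term_closed) (use f u that in auto)
  have t': "?t (Suc m) i \<in> carrier R" if "i \<in> {1..Suc m}" for i
    by (rule replaced_term_closed) (use f u that in auto)
  have fm: "f (Suc m) \<in> carrier R" and um: "u (Suc m) \<in> carrier R"
    using f u by auto
  have Xm: "ordprod R f 1 m \<in> carrier R"
    by (rule ordprod_closed) (use f in auto)
  have step: "?t (Suc m) i = ?t m i \<otimes> f (Suc m)" if i: "i \<in> {1..m}" for i
  proof -
    have "ordprod R f 1 (i - 1) \<in> carrier R" "ordprod R f (i + 1) m \<in> carrier R"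
      using f i by (auto intro!: ordprod_closed)
    moreover have "ordprod R f (i + 1) (Suc m) = ordprod R f (i + 1) m \<otimes> f (Suc m)"
      by (rule ordprod_Suc) (use f i in auto)
    ultimately show ?thesis
      using u i fm by (simp add: m_assoc)
  qed
  have "replaced_sum R f u (Suc m) = ?t (Suc m) (Suc m) \<oplus> (\<Oplus>i\<in>{1..m}. ?t (Suc m) i)"
  proof -
    have "{1..Suc m} = insert (Suc m) {1..m}" by auto
    then have "replaced_sum R f u (Suc m) = (\<Oplus>i\<in>insert (Suc m) {1..m}. ?t (Suc m) i)"
      by (simp only: replaced_sum_def)
    also have "\<dots> = ?t (Suc m) (Suc m) \<oplus> (\<Oplus>i\<in>{1..m}. ?t (Suc m) i)"
      by (rule finsum_insert) (simp, simp, rule Pi_I, rule t', simp, rule t', simp)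
    finally show ?thesis .
  qed
  \<comment> \<open>To the right of the last position the product runs from \<open>m + 2\<close> to
    \<open>m + 1\<close>, so it is the unit.\<close>
  also have "?t (Suc m) (Suc m) = ordprod R f 1 m \<otimes> u (Suc m)"
    using Xm um by (simp add: ordprod_empty)
  also have "(\<Oplus>i\<in>{1..m}. ?t (Suc m) i) = (\<Oplus>i\<in>{1..m}. ?t m i \<otimes> f (Suc m))"
    by (rule finsum_cong') (use step t fm in auto)
  also have "\<dots> = replaced_sum R f u m \<otimes> f (Suc m)"
    unfolding replaced_sum_def by (rule finsum_ldistr[symmetric]) (use t fm in auto)
  finally show ?thesis
    using Xm um fm replaced_sum_closed[of m f u] f u by (simp add: a_comm)
qed

end

context reynolds_algebra_weight_m1
begin

lemma P_carrier [simp, intro]: "x \<in> carrier R \<Longrightarrow> P x \<in> carrier R"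
  using P_closed by auto

lemma P_abelian_group_hom: "abelian_group_hom R R P"
  by (rule abelian_group_homI)
    (auto simp: abelian_group_axioms group_hom_def group_hom_axioms_def hom_def a_group P_add)

lemma P_zero: "P \<zero>\<^bsub>R\<^esub> = \<zero>\<^bsub>R\<^esub>"
  by (rule abelian_group_hom.hom_zero[OF P_abelian_group_hom])

lemma P_minus:
  assumes "x \<in> carrier R" "y \<in> carrier R"
  shows "P (x \<ominus>\<^bsub>R\<^esub> y) = P x \<ominus>\<^bsub>R\<^esub> P y"
  using assms
  by (simp add: minus_eq P_add abelian_group_hom.hom_a_inv[OF P_abelian_group_hom])

lemma P_add_pow: "x \<in> carrier R \<Longrightarrow> P (add_pow R (n::nat) x) = add_pow R n (P x)"
  by (induction n) (auto simp: P_zero P_add)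

lemma P_finsum:
  "finite A \<Longrightarrow> (\<And>i. i \<in> A \<Longrightarrow> f i \<in> carrier R) \<Longrightarrow>
    P (\<Oplus>\<^bsub>R\<^esub>i\<in>A. f i) = (\<Oplus>\<^bsub>R\<^esub>i\<in>A. P (f i))"
  by (induction A rule: finite_induct) (auto simp: P_zero P_add Pi_def)

text \<open>The product recurs inside the argument of \<open>P\<close>; this fixed-point form
  exhibits it as a value of \<open>P\<close>, as the Reynolds identity requires. Writing the length
  as \<open>Suc n\<close> makes the multiplier \<open>n\<close> and starts the induction at a single
  factor.\<close>

lemma ordprod_P_eq:
  assumes "\<And>i. i \<in> {1..Suc n} \<Longrightarrow> u i \<in> carrier R"
  shows "ordprod R (\<lambda>i. P (u i)) 1 (Suc n) =
    P (replaced_sum R (\<lambda>i. P (u i)) u (Suc n) \<ominus>\<^bsub>R\<^esub>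
       add_pow R n (ordprod R (\<lambda>i. P (u i)) 1 (Suc n)))"
  using assms
proof (induction n)
  case 0
  then have "u 1 \<in> carrier R" by simp
  \<comment> \<open>For one factor the replaced sum is \<open>u 1\<close> and the multiple is zero,
    so both sides are \<open>P (u 1)\<close>.\<close>
  then show ?case
    by (simp add: ordprod_def replaced_sum_def minus_eq)
next
  case (Suc n)
  let ?f = "\<lambda>i. P (u i)"
  let ?X = "ordprod R ?f 1" and ?S = "replaced_sum R ?f u"
  let ?v = "u (Suc (Suc n))"
  let ?W = "?S (Suc n) \<ominus>\<^bsub>R\<^esub> add_pow R n (?X (Suc n))"
  have v: "?v \<in> carrier R" and X: "?X (Suc n) \<in> carrier R" and S: "?S (Suc n) \<in> carrier R"
    using Suc.prems by (auto intro!: ordprod_closed replaced_sum_closed)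
  then have W: "?W \<in> carrier R" by simp
  have XW: "?X (Suc n) = P ?W"
    by (rule Suc.IH) (use Suc.prems in auto)
  have XS: "?X (Suc (Suc n)) = ?X (Suc n) \<otimes>\<^bsub>R\<^esub> P ?v"
    by (rule ordprod_Suc) (use Suc.prems in auto)
  have SS: "?S (Suc (Suc n)) = ?S (Suc n) \<otimes>\<^bsub>R\<^esub> P ?v \<oplus>\<^bsub>R\<^esub> ?X (Suc n) \<otimes>\<^bsub>R\<^esub> ?v"
    by (rule replaced_sum_Suc) (use Suc.prems in auto)
  have "?X (Suc (Suc n)) = P ?W \<otimes>\<^bsub>R\<^esub> P ?v"
    using XS XW by simp
  also have "\<dots> = P (?W \<otimes>\<^bsub>R\<^esub> P ?v) \<oplus>\<^bsub>R\<^esub> P (P ?W \<otimes>\<^bsub>R\<^esub> ?v) \<ominus>\<^bsub>R\<^esub> P (P ?W \<otimes>\<^bsub>R\<^esub> P ?v)"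
    by (rule reynolds[OF W v])
  \<comment> \<open>By \<open>XW\<close>, each \<open>P ?W\<close> turns back into the shorter
    product, so the subtracted term is \<open>P\<close> of the longer product; additivity then
    collects everything under one \<open>P\<close>.\<close>
  also have "\<dots> = P (?W \<otimes>\<^bsub>R\<^esub> P ?v \<oplus>\<^bsub>R\<^esub> ?X (Suc n) \<otimes>\<^bsub>R\<^esub> ?v \<ominus>\<^bsub>R\<^esub> ?X (Suc (Suc n)))"
    using W X v unfolding XW[symmetric] XS by (simp add: P_add P_minus)
  \<comment> \<open>Multiplying \<open>?W\<close> by \<open>P ?v\<close> turns its \<open>n\<close>
    subtracted copies into copies of the longer product; the Reynolds identity supplies one more,
    which gives \<open>Suc n\<close>.\<close>
  also have "?W \<otimes>\<^bsub>R\<^esub> P ?v \<oplus>\<^bsub>R\<^esub> ?X (Suc n) \<otimes>\<^bsub>R\<^esub> ?v \<ominus>\<^bsub>R\<^esub> ?X (Suc (Suc n)) =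
      ?S (Suc (Suc n)) \<ominus>\<^bsub>R\<^esub> add_pow R (Suc n) (?X (Suc (Suc n)))"
  proof -
    have "?W \<otimes>\<^bsub>R\<^esub> P ?v = ?S (Suc n) \<otimes>\<^bsub>R\<^esub> P ?v \<ominus>\<^bsub>R\<^esub> add_pow R n (?X (Suc (Suc n)))"
      using S X v unfolding XS by (simp add: minus_eq l_distr l_minus add_pow_ldistr)
    then show ?thesis
      using S X v unfolding SS XS
      by (simp add: minus_eq minus_add a_ac)
  qed
  finally show ?case .
qed

end

theorem proposition2p13:
  fixes K (structure) and R (structure) and P :: "'c \<Rightarrow> 'c"
    and m :: nat and u :: "nat \<Rightarrow> 'c"
  assumes "reynolds_algebra_weight_m1 K R P"
    and "m \<ge> 2"
    and "\<And>i. i \<in> {1..m} \<Longrightarrow> u i \<in> carrier R"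
  shows "add_pow R (m - 1) (P (ordprod R (\<lambda>i. P (u i)) 1 m)) =
    (\<Oplus>\<^bsub>R\<^esub>i\<in>{1..m}.
        P (ordprod R (\<lambda>j. P (u j)) 1 (i - 1) \<otimes>\<^bsub>R\<^esub> u i \<otimes>\<^bsub>R\<^esub> ordprod R (\<lambda>j. P (u j)) (i + 1) m))
      \<ominus>\<^bsub>R\<^esub> ordprod R (\<lambda>i. P (u i)) 1 m"
proof -
  interpret reynolds_algebra_weight_m1 K R P by fact
  let ?f = "\<lambda>i. P (u i)"
  let ?X = "ordprod R ?f 1 m" and ?S = "replaced_sum R ?f u m"
  obtain n where m: "m = Suc n"
    using assms(2) by (cases m) auto
  have f: "?f i \<in> carrier R" if "i \<in> {1..m}" for i
    using assms(3) that by auto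
  have X: "?X \<in> carrier R" and S: "?S \<in> carrier R"
    by (intro ordprod_closed f, assumption) (intro replaced_sum_closed f assms(3))
  have "?X = P (?S \<ominus>\<^bsub>R\<^esub> add_pow R (m - 1) ?X)"
    using ordprod_P_eq[of n u] assms(3) m by simp
  also have "\<dots> = P ?S \<ominus>\<^bsub>R\<^esub> add_pow R (m - 1) (P ?X)"
    using X S by (simp add: P_minus P_add_pow)
  finally have eq: "?X = P ?S \<ominus>\<^bsub>R\<^esub> add_pow R (m - 1) (P ?X)" .
  \<comment> \<open>Solving \<open>eq\<close> for the multiple: write \<open>a\<close> as
    \<open>b - (b - a)\<close> with \<open>b = P ?S\<close>, where the bracket is
    \<open>?X\<close>.\<close>
  have "add_pow R (m - 1) (P ?X) = P ?S \<ominus>\<^bsub>R\<^esub> (P ?S \<ominus>\<^bsub>R\<^esub> add_pow R (m - 1) (P ?X))"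
    using X S by (simp add: minus_eq minus_add r_neg2)
  also have "\<dots> = P ?S \<ominus>\<^bsub>R\<^esub> ?X"
    using eq by simp
  also have "P ?S = (\<Oplus>\<^bsub>R\<^esub>i\<in>{1..m}.
      P (ordprod R ?f 1 (i - 1) \<otimes>\<^bsub>R\<^esub> u i \<otimes>\<^bsub>R\<^esub> ordprod R ?f (i + 1) m))"
    unfolding replaced_sum_def
    by (intro P_finsum finite_atLeastAtMost replaced_term_closed f assms(3))
  finally show ?thesis .
qed

end
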